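(* For every integer $n\ge 2$, with $t_m=m(m+1)/2$ denoting the $m$-th triangular number, $$ g(t_n,t_{n+1},t_{n+2};1)=n(n+1)(n+2)-1\,. $$
   Context: For positive integers $a_1,\dots,a_k$ with $\gcd(a_1,\dots,a_k)=1$ and an integer $N$, let $d(N;a_1,\dots,a_k)$ denote the number of $k$-tuples $(x_1,\dots,x_k)$ of nonnegative integers with $a_1x_1+\cdots+a_kx_k=N$. For a nonnegative integer $q$, $g(a_1,\dots,a_k;q)$ denotes the largest integer $N$ such that $d(N;a_1,\dots,a_k)\le q$. It is known that $\gcd(t_n,t_{n+1},t_{n+2})=1$. *)

theory Defs
  imports Main
begin

definition triangular :: "nat \<Rightarrow> nat" where
  "triangular m = m * (m + 1) div 2"

text \<open>Intended for lists of positive coefficients. A zero coefficient may make the solution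
  set infinite, and then \<^const>\<open>card\<close> returns 0.\<close>
definition denumerant :: "int \<Rightarrow> nat list \<Rightarrow> nat" where
  "denumerant N as =
     card {xs :: nat list. length xs = length as \<and>
                           (\<Sum>i<length as. int (as ! i) * int (xs ! i)) = N}"

text \<open>Intended for nonempty lists of positive integers with greatest common divisor 1, where the
  maximum exists. The maximum ranges over all integers, and every negative integer has
  denumerant 0, so the set is unbounded below and \<^const>\<open>Max\<close> is not applicable.
  The value is unspecified if there is no largest element.\<close>
definition frobenius :: "nat list \<Rightarrow> nat \<Rightarrow> int" where
  "frobenius as q = (GREATEST N. denumerant N as \<le> q)"

end

theory Submission
  imports Defs "HOL-Number_Theory.Cong"
begin

text \<open>Write \<open>t\<^sub>n = d p\<close>, \<open>t\<^sub>n\<^sub>+\<^sub>1 = d e\<close>, \<open>t\<^sub>n\<^sub>+\<^sub>2 = e q\<close> with \<open>d = gcd(t\<^sub>n, t\<^sub>n\<^sub>+\<^sub>1)\<close> and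
  \<open>e = gcd(t\<^sub>n\<^sub>+\<^sub>1, t\<^sub>n\<^sub>+\<^sub>2)\<close>. The integer relations between these three numbers are generated by
  \<open>(e, -p, 0)\<close> and \<open>(0, -q, d)\<close>, so every \<open>N\<close> has a unique representation
  \<open>(x\<^sub>0, y\<^sub>0, z\<^sub>0)\<close> with \<open>0 \<le> x\<^sub>0 < e\<close> and \<open>0 \<le> z\<^sub>0 < d\<close>, and its representations with nonnegative \<open>x\<close>, \<open>z\<close> are
  \<open>(x\<^sub>0 + e i, y\<^sub>0 - p i - q j, z\<^sub>0 + d j)\<close> with \<open>i, j \<ge> 0\<close>. At most one of these is nonnegative iff
  \<open>y\<^sub>0 < min p q\<close>, and the largest such \<open>N\<close> has \<open>x\<^sub>0 = e - 1\<close>, \<open>y\<^sub>0 = min p q - 1\<close>,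
  \<open>z\<^sub>0 = d - 1\<close>.\<close>

text \<open>Only uniqueness is asked of \<open>(x0, y0, z0)\<close>: if it is no solution, the
  solution set is empty and the bound still holds.\<close>

lemma denumerant_le_1I:
  assumes "\<And>x y z. int a * int x + int b * int y + int c * int z = N
             \<Longrightarrow> (x, y, z) = (x0, y0, z0)"
  shows "denumerant N [a, b, c] \<le> 1"
proof -
  let ?S = "{xs :: nat list. length xs = length [a, b, c] \<and>
              (\<Sum>i<length [a, b, c]. int ([a, b, c] ! i) * int (xs ! i)) = N}"
  have "xs = [x0, y0, z0]" if "xs \<in> ?S" for xs
  proof -
    from that obtain x y z where "xs = [x, y, z]"
      by (auto simp: length_Suc_conv)
    with that assms[of x y z] show ?thesis
      by (simp add: lessThan_Suc algebra_simps)
  qed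
  then have "?S \<subseteq> {[x0, y0, z0]}"
    by blast
  then have "card ?S \<le> card {[x0, y0, z0]}"
    by (intro card_mono) auto
  then show ?thesis
    by (simp add: denumerant_def)
qed

text \<open>Positive coefficients bound every entry of a solution by \<open>N\<close>, so the
  solution set is finite; on an infinite set \<open>card\<close> would be 0.\<close>

lemma denumerant_ge_2I:
  assumes pos: "a > 0" "b > 0" "c > 0"
    and sol: "int a * int x + int b * int y + int c * int z = N"
    and sol': "int a * int x' + int b * int y' + int c * int z' = N"
    and neq: "(x, y, z) \<noteq> (x', y', z')"
  shows "denumerant N [a, b, c] \<ge> 2"
proof -
  let ?as = "[a, b, c]"
  let ?S = "{xs :: nat list. length xs = length ?as \<and>
              (\<Sum>i<length ?as. int (?as ! i) * int (xs ! i)) = N}"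
  have "?S \<subseteq> {xs. set xs \<subseteq> {..nat N} \<and> length xs = length ?as}"
  proof (intro subsetI CollectI conjI)
    fix xs v
    assume xs: "xs \<in> ?S" and "v \<in> set xs"
    then obtain j where j: "j < length ?as" "v = xs ! j"
      by (auto simp: in_set_conv_nth)
    have "?as ! j > 0"
      using j(1) pos by (auto simp: nth_Cons split: nat.splits)
    then have "int v \<le> int (?as ! j) * int (xs ! j)"
      using j(2) by (simp add: mult_le_cancel_right1)
    also have "\<dots> \<le> (\<Sum>i<length ?as. int (?as ! i) * int (xs ! i))"
      by (rule member_le_sum) (use j in auto)
    also have "\<dots> = N"
      using xs by simp
    finally show "v \<in> {..nat N}"
      by simp
  qed simp
  then have "finite ?S"
    by (rule finite_subset) (simp only: finite_lists_length_eq finite_atMost)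
  moreover have "{[x, y, z], [x', y', z']} \<subseteq> ?S"
    using sol sol' by (auto simp: numeral_3_eq_3 lessThan_Suc algebra_simps)
  ultimately have "card {[x, y, z], [x', y', z']} \<le> card ?S"
    by (rule card_mono)
  then show ?thesis
    using neq by (simp add: denumerant_def split: if_splits)
qed

text \<open>\<open>u\<close> is invertible modulo \<open>d\<close>, and \<open>z\<close> is the
  residue of the inverse times \<open>N\<close>. Used with moduli \<open>d\<close> and then
  \<open>e\<close>, this yields the normalised representation.\<close>

lemma linear_cong_solution:
  fixes u d N :: int
  assumes "coprime u d" "d > 0"
  obtains z k where "0 \<le> z" "z < d" "N = u * z + d * k"
proof -
  obtain w where "[u * w = 1] (mod d)"
    using cong_solve_coprime_int[OF assms(1)] ..
  then have "[u * w * N = 1 * N] (mod d)"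
    by (rule cong_scalar_right)
  then have "[u * (w * N mod d) = N] (mod d)"
    by (simp add: cong_def mod_mult_right_eq mult.assoc)
  then have "d dvd N - u * (w * N mod d)"
    by (simp add: cong_iff_dvd_diff dvd_diff_commute)
  then obtain k where "N - u * (w * N mod d) = d * k" ..
  then have "N = u * (w * N mod d) + d * k"
    by (simp add: algebra_simps)
  moreover have "0 \<le> w * N mod d" "w * N mod d < d"
    using assms(2) by simp_all
  ultimately show ?thesis
    by (intro that)
qed

lemma frobenius_three_chain:
  fixes d e p q :: nat
  assumes pos: "d > 0" "e > 0" "p > 0" "q > 0"
    and cop: "coprime d e" "coprime d q" "coprime e p"
  shows "frobenius [d * p, d * e, e * q] 1
    = int d * int e * (int p + int q + int (min p q)) - int d * int p - int d * int e - int e * int q"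
    (is "_ = ?G")
  unfolding frobenius_def
proof (rule Greatest_equality)
  let ?r = "min p q"
  show "denumerant ?G [d * p, d * e, e * q] \<le> 1"
  proof (rule denumerant_le_1I[where ?x0.0 = "e - 1" and ?y0.0 = "?r - 1" and ?z0.0 = "d - 1"])
    fix x y z :: nat
    assume "int (d * p) * int x + int (d * e) * int y + int (e * q) * int z = ?G"
    \<comment> \<open>Adding all three coefficients shifts to positive unknowns and leaves a right
      side divisible by \<open>d * e\<close>, ready for reduction modulo \<open>d\<close> and modulo
      \<open>e\<close>.\<close>
    then have "int (d * p * (x + 1) + d * e * (y + 1) + e * q * (z + 1)) = int (d * e * (p + q + ?r))"
      unfolding of_nat_add of_nat_mult of_nat_1 by (simp add: algebra_simps)
    then have eq: "d * p * (x + 1) + d * e * (y + 1) + e * q * (z + 1) = d * e * (p + q + ?r)"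
      by (simp only: of_nat_eq_iff)
    have "d dvd d * p * (x + 1) + d * e * (y + 1) + e * q * (z + 1)"
      unfolding eq by (simp only: mult.assoc dvd_triv_left)
    moreover have "d dvd d * p * (x + 1) + d * e * (y + 1)"
      by (simp add: mult.assoc)
    ultimately have "d dvd e * q * (z + 1)"
      using dvd_add_right_iff by blast
    moreover have "coprime d (e * q)"
      using cop by simp
    ultimately have "d dvd z + 1"
      by (simp only: coprime_dvd_mult_right_iff)
    then obtain j where j: "z + 1 = d * j" ..
    have "e dvd d * e * (p + q + ?r)"
      by simp
    then have "e dvd d * p * (x + 1) + (d * e * (y + 1) + e * q * (z + 1))"
      unfolding eq[symmetric] by (simp only: add.assoc)
    moreover have "e dvd d * e * (y + 1) + e * q * (z + 1)"
      by (intro dvd_add) simp_all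
    ultimately have "e dvd d * p * (x + 1)"
      using dvd_add_left_iff by blast
    moreover have "coprime e (d * p)"
      using cop by (simp add: coprime_commute)
    ultimately have "e dvd x + 1"
      by (simp only: coprime_dvd_mult_right_iff)
    then obtain i where i: "x + 1 = e * i" ..
    have "d * e * (p * i + (y + 1) + q * j) = d * e * (p + q + ?r)"
      using eq unfolding i j by (simp add: algebra_simps)
    then have eq': "p * i + (y + 1) + q * j = p + q + ?r"
      using pos by (simp only: mult_cancel1) auto
    have ij: "i \<ge> 1" "j \<ge> 1"
      using i j by (auto intro!: Suc_leI gr0I)
    \<comment> \<open>With \<open>i\<close> \<ge> 2 the terms \<open>p * i + q * j\<close> already
      reach \<open>p + q + ?r\<close>, leaving no room for \<open>y + 1\<close>; likewise for
      \<open>j\<close>.\<close>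
    have "i < 2"
    proof (rule ccontr)
      assume "\<not> i < 2"
      then have "p * 2 \<le> p * i" "q * 1 \<le> q * j"
        using ij by (auto intro: mult_le_mono2)
      with eq' show False by linarith
    qed
    moreover have "j < 2"
    proof (rule ccontr)
      assume "\<not> j < 2"
      then have "p * 1 \<le> p * i" "q * 2 \<le> q * j"
        using ij by (auto intro: mult_le_mono2)
      with eq' show False by linarith
    qed
    ultimately have "i = 1" "j = 1"
      using ij by auto
    with i j eq' show "(x, y, z) = (e - 1, ?r - 1, d - 1)"
      by auto
  qed
next
  let ?r = "min p q"
  fix N
  assume le1: "denumerant N [d * p, d * e, e * q] \<le> 1"
  show "N \<le> ?G"
  proof (rule ccontr)
    assume "\<not> N \<le> ?G"
    then have N: "N > ?G" by simp
    have "coprime (int (e * q)) (int d)" "int d > 0"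
      using cop pos by (simp_all add: coprime_commute)
    then obtain z M where z: "0 \<le> z" "z < int d" "N = int (e * q) * z + int d * M"
      by (rule linear_cong_solution)
    have "coprime (int p) (int e)" "int e > 0"
      using cop pos by (simp_all add: coprime_commute)
    then obtain x y where x: "0 \<le> x" "x < int e" "M = int p * x + int e * y"
      by (rule linear_cong_solution)
    have N_eq: "N = int (d * p) * x + int (d * e) * y + int (e * q) * z"
      using z(3) x(3) by (simp add: algebra_simps)
    \<comment> \<open>Putting the maxima \<open>e - 1\<close> and \<open>d - 1\<close> for
      \<open>x\<close> and \<open>z\<close> cancels all but the \<open>y\<close> terms in
      \<open>N > ?G\<close>.\<close>
    have "int (d * p) * x \<le> int (d * p) * (int e - 1)" "int (e * q) * z \<le> int (e * q) * (int d - 1)"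
      using x z by (auto intro!: mult_left_mono)
    with N N_eq have "int (d * e) * (int ?r - 1) < int (d * e) * y"
      by (simp add: algebra_simps del: of_nat_min)
    moreover have "int (d * e) > 0"
      using pos by simp
    ultimately have "int ?r - 1 < y"
      by (simp only: mult_less_cancel_left_pos)
    then have y: "int ?r \<le> y"
      by linarith
    obtain x0 y0 z0 where nats: "x = int x0" "y = int y0" "z = int z0"
      using that[of "nat x" "nat y" "nat z"] x z y by simp
    have "denumerant N [d * p, d * e, e * q] \<ge> 2"
    \<comment> \<open>The cheaper exchange is affordable: \<open>p\<close> copies of
      \<open>d * e\<close> equal \<open>e\<close> copies of \<open>d * p\<close>, and
      \<open>q\<close> copies equal \<open>d\<close> copies of \<open>e * q\<close>.\<close>
    proof (cases "p \<le> q")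
      case True
      then have "p \<le> y0" using y nats by simp
      then show ?thesis
        using pos N_eq unfolding nats
        by (intro denumerant_ge_2I[where x = x0 and y = y0 and z = z0
              and x' = "x0 + e" and y' = "y0 - p" and z' = z0])
           (auto simp: of_nat_diff algebra_simps)
    next
      case False
      then have "q \<le> y0" using y nats by simp
      then show ?thesis
        using pos N_eq unfolding nats
        by (intro denumerant_ge_2I[where x = x0 and y = y0 and z = z0
              and x' = x0 and y' = "y0 - q" and z' = "z0 + d"])
           (auto simp: of_nat_diff algebra_simps)
    qed
    with le1 show False by simp
  qed
qed

theorem theorem2:
  fixes n :: nat
  assumes "n \<ge> 2"
  shows "frobenius [triangular n, triangular (n + 1), triangular (n + 2)] 1
           = int n * (int n + 1) * (int n + 2) - 1"
proof -
  have cop: "coprime m (k * m + r) \<longleftrightarrow> coprime m r" for m k r :: nat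
    by (simp add: coprime_iff_gcd_eq_1 gcd_add_mult)
  have tri: "triangular m = k" if "2 * k = m * (m + 1)" for m k
    unfolding triangular_def that[symmetric] by simp
  show ?thesis
  \<comment> \<open>Parity decides which factor absorbs the division by 2: \<open>d\<close> is n+1
    and \<open>e\<close> is (n+2)/2 for even \<open>n\<close>, while \<open>d\<close> is (n+1)/2 and
    \<open>e\<close> is n+2 for odd \<open>n\<close>.\<close>
  proof (cases "even n")
    case True
    then obtain m where n: "n = 2 * m" ..
    have t: "triangular n = (2 * m + 1) * m" "triangular (n + 1) = (2 * m + 1) * (m + 1)"
      "triangular (n + 2) = (m + 1) * (2 * m + 3)"
      unfolding n by (auto intro!: tri simp: algebra_simps)
    have "coprime (2 * m + 1) (m + 1)"
      using cop[of "m + 1" 1 m] by (simp add: coprime_commute mult_2)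
    moreover have "coprime (2 * m + 1) (2 * m + 3)"
      using cop[of "2 * m + 1" 1 2] by (simp add: numeral_3_eq_3 mult_2)
    ultimately have "frobenius [triangular n, triangular (n + 1), triangular (n + 2)] 1
      = int (2 * m + 1) * int (m + 1) * (int m + int (2 * m + 3) + int m)
        - int (2 * m + 1) * int m - int (2 * m + 1) * int (m + 1) - int (m + 1) * int (2 * m + 3)"
      unfolding t using assms n
        frobenius_three_chain[of "2 * m + 1" "m + 1" m "2 * m + 3"] by simp
    then show ?thesis
      unfolding n of_nat_add of_nat_mult of_nat_numeral of_nat_1 by algebra
  next
    case False
    then obtain k where n: "n = 2 * k + 1" by (rule oddE)
    have t: "triangular n = (k + 1) * (2 * k + 1)" "triangular (n + 1) = (k + 1) * (2 * k + 3)"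
      "triangular (n + 2) = (2 * k + 3) * (k + 2)"
      unfolding n by (auto intro!: tri simp: algebra_simps)
    have "coprime (k + 1) (2 * k + 3)"
      using cop[of "k + 1" 2 1] by (simp add: numeral_3_eq_3 algebra_simps)
    moreover have "coprime (k + 1) (k + 2)"
      using cop[of "k + 1" 1 1] by (simp add: algebra_simps)
    moreover have "coprime (2 * k + 3) (2 * k + 1)"
      using cop[of "2 * k + 1" 1 2]
      by (simp add: coprime_commute numeral_3_eq_3 mult_2)
    \<comment> \<open>This needs k \<ge> 1, hence n \<ge> 2; in the even case the same bound gives
      \<open>m > 0\<close>.\<close>
    moreover have "min (2 * k + 1) (k + 2) = k + 2"
      using assms n by simp
    ultimately have "frobenius [triangular n, triangular (n + 1), triangular (n + 2)] 1
      = int (k + 1) * int (2 * k + 3) * (int (2 * k + 1) + int (k + 2) + int (k + 2))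
        - int (k + 1) * int (2 * k + 1) - int (k + 1) * int (2 * k + 3) - int (2 * k + 3) * int (k + 2)"
      unfolding t using frobenius_three_chain[of "k + 1" "2 * k + 3" "2 * k + 1" "k + 2"] by simp
    then show ?thesis
      unfolding n of_nat_add of_nat_mult of_nat_numeral of_nat_1 by algebra
  qed
qed

end
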